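(* For any $p>1$ there exist $\epsilon=\epsilon(p)>0$ and $C=C(p)<\infty$ such that the following holds. Let $d,n\ge1$ be integers, let $\mathbf x=(x_i)_{i=1}^n$ and $\mathbf y=(y_j)_{j=1}^n$ be two families of points in $[0,1]^d$, and let $\sigma$ be a permutation of $\{1,\dots,n\}$ that is an optimiser for the $p$-cost, i.e. it attains the minimum \[ \min_{\sigma'\in\mathcal S_n}\sum_{i=1}^n|x_i-y_{\sigma'(i)}|^p . \] For $i\in\{1,\dots,n\}$ set \[ B_i=B\!\left(\frac{x_i+y_{\sigma(i)}}2,\ \epsilon\,|x_i-y_{\sigma(i)}|\right). \] Then, for every $i\in\{1,\dots,n\}$, \[ N^{\mathbf x}_{B_i}\cdot|x_i-y_{\sigma(i)}|^p\ \le\ C\sum_{j:\ x_j\in B_i}|x_j-y_{\sigma(j)}|^p . \]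
   Context: $|\cdot|$ is the Euclidean norm on $\mathbb R^d$; $B(x,r)$ is the Euclidean ball in $\mathbb R^d$ with centre $x$ and radius $r$; $\mathcal S_n$ is the set of permutations of $\{1,\dots,n\}$; and $N^{\mathbf x}_\Omega=\#\{j\in\{1,\dots,n\}: x_j\in\Omega\}$ for a set $\Omega$. *)

theory Defs
  imports "HOL-Analysis.Analysis" "HOL-Combinatorics.Permutations"
begin

text \<open>
  The constants of the theorem may not depend on the dimension, so the dimension has to be an
  ordinary variable.  Points of d-dimensional space are therefore the elements of
  \<^term>\<open>topspace (Euclidean_space d)\<close>: functions on the naturals, with coordinates
  \<open>0, \<dots>, d - 1\<close>, that vanish from index \<open>d\<close> on.
\<close>

definition euc_norm :: "nat \<Rightarrow> (nat \<Rightarrow> real) \<Rightarrow> real" where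
  "euc_norm d u = L2_set u {..<d}"

definition euc_dist :: "nat \<Rightarrow> (nat \<Rightarrow> real) \<Rightarrow> (nat \<Rightarrow> real) \<Rightarrow> real" where
  "euc_dist d u v = euc_norm d (\<lambda>k. u k - v k)"

text \<open>Balls are open, as for the library constant \<^const>\<open>ball\<close>.\<close>

definition euc_ball :: "nat \<Rightarrow> (nat \<Rightarrow> real) \<Rightarrow> real \<Rightarrow> (nat \<Rightarrow> real) set" where
  "euc_ball d c r = {u \<in> topspace (Euclidean_space d). euc_dist d c u < r}"

definition euc_midpoint :: "(nat \<Rightarrow> real) \<Rightarrow> (nat \<Rightarrow> real) \<Rightarrow> nat \<Rightarrow> real" where
  "euc_midpoint u v = (\<lambda>k. (u k + v k) / 2)"

definition unit_cube :: "nat \<Rightarrow> (nat \<Rightarrow> real) set" where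
  "unit_cube d = {u \<in> topspace (Euclidean_space d). \<forall>k<d. u k \<in> {0..1}}"

definition p_cost ::
  "real \<Rightarrow> nat \<Rightarrow> nat \<Rightarrow> (nat \<Rightarrow> nat \<Rightarrow> real) \<Rightarrow> (nat \<Rightarrow> nat \<Rightarrow> real) \<Rightarrow> (nat \<Rightarrow> nat) \<Rightarrow> real" where
  "p_cost p d n x y \<sigma> = (\<Sum>i\<in>{1..n}. euc_dist d (x i) (y (\<sigma> i)) powr p)"

definition p_optimiser ::
  "real \<Rightarrow> nat \<Rightarrow> nat \<Rightarrow> (nat \<Rightarrow> nat \<Rightarrow> real) \<Rightarrow> (nat \<Rightarrow> nat \<Rightarrow> real) \<Rightarrow> (nat \<Rightarrow> nat) \<Rightarrow> bool" where
  "p_optimiser p d n x y \<sigma> \<longleftrightarrow>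
     is_arg_min (p_cost p d n x y) (\<lambda>\<sigma>'. \<sigma>' permutes {1..n}) \<sigma>"

text \<open>Points are counted with multiplicity: the count is over indices.\<close>

definition num_points :: "nat \<Rightarrow> (nat \<Rightarrow> nat \<Rightarrow> real) \<Rightarrow> (nat \<Rightarrow> real) set \<Rightarrow> nat" where
  "num_points n x \<Omega> = card {j \<in> {1..n}. x j \<in> \<Omega>}"

end

theory Submission
  imports Defs
begin

text \<open>
  Write \<open>D\<close> for the length of the pair \<open>i\<close>, that is, the distance from \<open>x i\<close> to its partner, and
  let \<open>x j\<close> lie in the ball of radius \<open>\<epsilon> * D\<close> around the midpoint of that pair.  The point is that
  the pair \<open>j\<close> cannot be much shorter than the pair \<open>i\<close>: its length \<open>a\<close> is at least \<open>\<epsilon> * D\<close>.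

  Indeed, exchanging the partners of \<open>i\<close> and \<open>j\<close> replaces two pairs of lengths \<open>D\<close> and \<open>a\<close> by one
  of length at most \<open>(1/2 + \<epsilon>) * D\<close> and one of length at most \<open>(1/2 + \<epsilon>) * D + a\<close>.  If \<open>a\<close> were
  below \<open>\<epsilon> * D\<close>, the two new pairs together would cost at most \<open>2 * ((1/2 + 2 * \<epsilon>) * D) powr p\<close>.  Since
  \<open>p > 1\<close>, splitting a distance into halves is strictly profitable,
  \<open>2 * (1/2) powr p < 1\<close>, and this persists for \<open>1/2 + 2 * \<epsilon>\<close> when \<open>\<epsilon>\<close> is small; the exchange
  would thus lower the cost, against optimality.

  Hence every term on the right-hand side is at least \<open>(\<epsilon> * D) powr p\<close>, and summation over the
  points in the ball gives the claim with \<open>C = \<epsilon> powr (-p)\<close>.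
\<close>

lemma euc_dist_nonneg: "0 \<le> euc_dist d u v"
  by (simp add: euc_dist_def euc_norm_def)

lemma euc_dist_commute: "euc_dist d u v = euc_dist d v u"
  by (simp add: euc_dist_def euc_norm_def L2_set_def power2_commute)

lemma euc_dist_triangle: "euc_dist d u w \<le> euc_dist d u v + euc_dist d v w"
  using L2_set_triangle_ineq[of "\<lambda>k. u k - v k" "\<lambda>k. v k - w k" "{..<d}"]
  by (simp add: euc_dist_def euc_norm_def)

lemma euc_dist_midpoint:
  "euc_dist d u (euc_midpoint u v) = euc_dist d u v / 2"
  "euc_dist d v (euc_midpoint u v) = euc_dist d u v / 2"
proof -
  have *: "euc_dist d u (euc_midpoint u v) = euc_dist d u v / 2" for u v
  proof -
    have "(\<lambda>k. u k - euc_midpoint u v k) = (\<lambda>k. (1/2) * (u k - v k))"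
      by (auto simp: euc_midpoint_def field_simps)
    then show ?thesis
      using L2_set_right_distrib[of "1/2" "\<lambda>k. u k - v k" "{..<d}"]
      by (simp add: euc_dist_def euc_norm_def)
  qed
  show "euc_dist d u (euc_midpoint u v) = euc_dist d u v / 2"
    by (rule *)
  have "euc_midpoint u v = euc_midpoint v u"
    by (auto simp: euc_midpoint_def add.commute)
  then show "euc_dist d v (euc_midpoint u v) = euc_dist d u v / 2"
    using *[of v u] by (simp add: euc_dist_commute)
qed

text \<open>
  Comparison of an optimal permutation with its composition with a transposition; this is
  cyclical monotonicity for cycles of length two.
\<close>

lemma optimal_permutation_swap:
  fixes c :: "'a \<Rightarrow> 'a \<Rightarrow> real"
  assumes "finite A" "i \<in> A" "j \<in> A"
    and opt: "is_arg_min (\<lambda>\<tau>. \<Sum>k\<in>A. c k (\<tau> k)) (\<lambda>\<tau>. \<tau> permutes A) \<sigma>"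
  shows "c i (\<sigma> i) + c j (\<sigma> j) \<le> c i (\<sigma> j) + c j (\<sigma> i)"
proof (cases "i = j")
  case False
  define \<tau> where "\<tau> = \<sigma> \<circ> Transposition.transpose i j"
  have "\<tau> permutes A"
    using assms unfolding \<tau>_def is_arg_min_def
    by (intro permutes_compose permutes_swap_id) auto
  then have le: "(\<Sum>k\<in>A. c k (\<sigma> k)) \<le> (\<Sum>k\<in>A. c k (\<tau> k))"
    using opt by (auto simp: is_arg_min_def not_less)
  have split: "(\<Sum>k\<in>A. f k) = f i + f j + (\<Sum>k\<in>A - {i, j}. f k)" for f :: "'a \<Rightarrow> real"
    using assms False sum.subset_diff[of "{i, j}" A f] by simp
  have "(\<Sum>k\<in>A - {i, j}. c k (\<tau> k)) = (\<Sum>k\<in>A - {i, j}. c k (\<sigma> k))"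
    by (rule sum.cong) (auto simp: \<tau>_def)
  with le show ?thesis
    by (simp add: split \<tau>_def)
qed simp

text \<open>
  The number \<open>(1/2) powr (1/p)\<close>, whose \<open>p\<close>-th power is one half, exceeds \<open>1/2\<close>
  because \<open>p > 1\<close>; any \<open>\<epsilon>\<close> with \<open>1/2 + 2 * \<epsilon>\<close> strictly between the two works.
\<close>

lemma exists_enlarged_half_powr_less:
  fixes p :: real
  assumes "p > 1"
  shows "\<exists>\<epsilon>>0. (1/2 + 2 * \<epsilon>) powr p < 1/2"
proof -
  define s where "s = (1/2::real) powr (1/p)"
  define \<epsilon> where "\<epsilon> = (s - 1/2) / 4"
  have "(1/2::real) powr 1 < (1/2) powr (1/p)"
    using assms by (intro powr_less_mono') auto
  then have "1/2 < s"
    by (simp add: s_def)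
  then have "0 < \<epsilon>" "1/2 + 2 * \<epsilon> < s"
    by (simp_all add: \<epsilon>_def field_simps)
  moreover from this have "(1/2 + 2 * \<epsilon>) powr p < s powr p"
    using assms by (intro powr_less_mono2) auto
  moreover have "s powr p = 1/2"
    using assms by (simp add: s_def powr_powr)
  ultimately show ?thesis
    by auto
qed

text \<open>
  The comparison of lengths at the heart of the argument, with \<open>b\<close> and \<open>b'\<close> the lengths that
  arise from \<open>D\<close> and \<open>a\<close> by the exchange.
\<close>

lemma swap_length_lower_bound:
  fixes p \<epsilon> D a b b' :: real
  assumes "p > 0" "\<epsilon> > 0" and small: "(1/2 + 2 * \<epsilon>) powr p < 1/2"
    and "0 \<le> D" "0 \<le> a" "0 \<le> b" "0 \<le> b'"
    and b: "b \<le> (1/2 + \<epsilon>) * D" and b': "b' \<le> (1/2 + \<epsilon>) * D + a"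
    and swap: "D powr p + a powr p \<le> b' powr p + b powr p"
  shows "\<epsilon> * D \<le> a"
proof (rule ccontr)
  assume "\<not> \<epsilon> * D \<le> a"
  then have a: "a < \<epsilon> * D"
    by simp
  with assms have "0 < D"
    by (cases "D = 0") auto
  let ?t = "1/2 + 2 * \<epsilon>"
  have "b \<le> ?t * D" "b' \<le> ?t * D"
    using a b b' \<open>0 \<le> a\<close> by (simp_all add: algebra_simps)
  then have "b powr p \<le> ?t powr p * D powr p" "b' powr p \<le> ?t powr p * D powr p"
    using assms powr_mono2[of p b "?t * D"] powr_mono2[of p b' "?t * D"]
    by (simp_all add: powr_mult)
  moreover have "?t powr p * D powr p < (1/2) * D powr p"
    using small \<open>0 < D\<close> by (intro mult_strict_right_mono) auto
  moreover have "0 \<le> a powr p"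
    by simp
  ultimately show False
    using swap by linarith
qed

text \<open>
  The midpoint is at distance \<open>D / 2\<close> from both ends of the pair \<open>i\<close>, so \<open>x j\<close> is within
  \<open>(1/2 + \<epsilon>) * D\<close> of both; the new pair at \<open>x i\<close> is measured by a detour through \<open>x j\<close>.
\<close>

lemma optimal_pair_length_near_midpoint:
  assumes "p > 0" "\<epsilon> > 0" and small: "(1/2 + 2 * \<epsilon>) powr p < 1/2"
    and opt: "p_optimiser p d n x y \<sigma>"
    and "i \<in> {1..n}" "j \<in> {1..n}"
    and ball: "x j \<in> euc_ball d (euc_midpoint (x i) (y (\<sigma> i))) (\<epsilon> * euc_dist d (x i) (y (\<sigma> i)))"
  shows "\<epsilon> * euc_dist d (x i) (y (\<sigma> i)) \<le> euc_dist d (x j) (y (\<sigma> j))"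
proof -
  let ?D = "euc_dist d (x i) (y (\<sigma> i))" and ?a = "euc_dist d (x j) (y (\<sigma> j))"
  let ?m = "euc_midpoint (x i) (y (\<sigma> i))"
  have near: "euc_dist d z (x j) \<le> (1/2 + \<epsilon>) * ?D" if "euc_dist d z ?m = ?D / 2" for z
    using euc_dist_triangle[of d z "x j" ?m] ball that by (simp add: euc_ball_def algebra_simps)
  have b: "euc_dist d (x j) (y (\<sigma> i)) \<le> (1/2 + \<epsilon>) * ?D"
    using near[OF euc_dist_midpoint(2)] by (simp add: euc_dist_commute)
  have b': "euc_dist d (x i) (y (\<sigma> j)) \<le> (1/2 + \<epsilon>) * ?D + ?a"
    using euc_dist_triangle[of d "x i" "y (\<sigma> j)" "x j"] near[OF euc_dist_midpoint(1)] by simp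
  have "is_arg_min (\<lambda>\<tau>. \<Sum>k\<in>{1..n}. euc_dist d (x k) (y (\<tau> k)) powr p)
      (\<lambda>\<tau>. \<tau> permutes {1..n}) \<sigma>"
    using opt by (simp add: p_optimiser_def p_cost_def[abs_def])
  then have swap: "?D powr p + ?a powr p
      \<le> euc_dist d (x i) (y (\<sigma> j)) powr p + euc_dist d (x j) (y (\<sigma> i)) powr p"
    using optimal_permutation_swap[of "{1..n}" i j "\<lambda>k l. euc_dist d (x k) (y l) powr p" \<sigma>]
      assms by simp
  show ?thesis
    using swap_length_lower_bound[OF assms(1,2) small _ _ _ _ b b' swap] by (simp add: euc_dist_nonneg)
qed

theorem lemma2p3:
  fixes p :: real
  assumes "p > 1"
  shows "\<exists>\<epsilon>::real. \<exists>C::real. \<epsilon> > 0 \<and>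
    (\<forall>(d::nat) (n::nat) (x::nat \<Rightarrow> nat \<Rightarrow> real) (y::nat \<Rightarrow> nat \<Rightarrow> real) (\<sigma>::nat \<Rightarrow> nat).
      d \<ge> 1 \<longrightarrow> n \<ge> 1 \<longrightarrow>
      (\<forall>i\<in>{1..n}. x i \<in> unit_cube d) \<longrightarrow>
      (\<forall>j\<in>{1..n}. y j \<in> unit_cube d) \<longrightarrow>
      p_optimiser p d n x y \<sigma> \<longrightarrow>
      (\<forall>i\<in>{1..n}.
        let B = euc_ball d (euc_midpoint (x i) (y (\<sigma> i))) (\<epsilon> * euc_dist d (x i) (y (\<sigma> i)))
        in real (num_points n x B) * euc_dist d (x i) (y (\<sigma> i)) powr p
             \<le> C * (\<Sum>j\<in>{j\<in>{1..n}. x j \<in> B}. euc_dist d (x j) (y (\<sigma> j)) powr p)))"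
proof -
  obtain \<epsilon> :: real where \<epsilon>: "\<epsilon> > 0" "(1/2 + 2 * \<epsilon>) powr p < 1/2"
    using exists_enlarged_half_powr_less[OF assms] by blast
  show ?thesis
  proof (rule exI[of _ \<epsilon>], rule exI[of _ "\<epsilon> powr (-p)"], intro conjI allI impI ballI)
    fix d n :: nat and x y :: "nat \<Rightarrow> nat \<Rightarrow> real" and \<sigma> :: "nat \<Rightarrow> nat" and i
    assume opt: "p_optimiser p d n x y \<sigma>" and i: "i \<in> {1..n}"
    let ?D = "euc_dist d (x i) (y (\<sigma> i))"
    define B where "B = euc_ball d (euc_midpoint (x i) (y (\<sigma> i))) (\<epsilon> * ?D)"
    let ?J = "{j \<in> {1..n}. x j \<in> B}"
    have "?D powr p \<le> \<epsilon> powr (-p) * euc_dist d (x j) (y (\<sigma> j)) powr p" if "j \<in> ?J" for j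
    proof -
      have "\<epsilon> * ?D \<le> euc_dist d (x j) (y (\<sigma> j))"
        using optimal_pair_length_near_midpoint[OF _ \<epsilon> opt i] assms that by (simp add: B_def)
      then have "(\<epsilon> * ?D) powr p \<le> euc_dist d (x j) (y (\<sigma> j)) powr p"
        using assms \<epsilon> by (intro powr_mono2) (auto simp: euc_dist_nonneg)
      then show ?thesis
        using \<epsilon> by (simp add: powr_mult euc_dist_nonneg powr_minus field_simps)
    qed
    then have "(\<Sum>j\<in>?J. ?D powr p) \<le> (\<Sum>j\<in>?J. \<epsilon> powr (-p) * euc_dist d (x j) (y (\<sigma> j)) powr p)"
      by (intro sum_mono)
    then have "real (num_points n x B) * ?D powr p
        \<le> \<epsilon> powr (-p) * (\<Sum>j\<in>?J. euc_dist d (x j) (y (\<sigma> j)) powr p)"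
      by (simp add: num_points_def sum_distrib_left)
    then show "let B = euc_ball d (euc_midpoint (x i) (y (\<sigma> i))) (\<epsilon> * ?D)
        in real (num_points n x B) * ?D powr p
          \<le> \<epsilon> powr (-p) * (\<Sum>j\<in>{j\<in>{1..n}. x j \<in> B}. euc_dist d (x j) (y (\<sigma> j)) powr p)"
      by (simp add: B_def Let_def)
  qed (rule \<epsilon>(1))
qed

end
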